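(* Let $N,\Gamma,K$ be finitely generated groups such that $$1\rightarrow N\rightarrow \Gamma \stackrel{\rho}{\rightarrow} K\rightarrow 1$$ is exact, where $\Gamma$ is generated by the finite set $X$, $N$ (regarded as a normal subgroup of $\Gamma$) is generated by the finite set $Y$, and $K=\Gamma/N$ is equipped with the generating set $\rho(X)$. Then, for $n\in\mathbb N$, $$ F_{\Gamma}(n)\leq F_{K}(|X|n)\; F_N\bigl(2n\, F_{K}(|X|n)^2\, \Delta_N^{\Gamma}(2F_{K}(|X|n)+1)\bigr).$$ Thus, if $N$ and $K$ have subrecursive F\o lner function and if $\Delta_N^\Gamma$ is subrecursive, then $\Gamma$ has subrecursive F\o lner function as well.
   Context: For a group $G$ generated by a finite set $S$ and $n\in\mathbb N$, an $n$-F\o lner set of $G$ (with respect to $S$) is a non-empty finite subset $F\subset G$ with $\frac{|F\setminus xF|}{|F|}\le n^{-1}$ for all $x\in S$. The F\o lner function of $G$ with respect to $S$ is $F_{G,S}(n):=\min\{|F|:\ F\subset G\text{ is } n\text{-F\o lner}\}$, written $F_G$ when $S$ is clear; here $F_\Gamma, F_N, F_K$ are taken with respect to $X$, $Y$, $\rho(X)$ respectively. The distortion function is $\Delta_N^{\Gamma}(n):=\max\{|\omega|_Y:\ \omega\in N,\ |\omega|_X\le n\}$, where $|\cdot|_X$ and $|\cdot|_Y$ denote word length with respect to $X\cup X^{-1}$ and $Y\cup Y^{-1}$. A function is subrecursive if it has a recursive upper bound. *)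

theory Defs
  imports "HOL-Algebra.Generated_Groups" "HOL-Library.Extended_Nat"
    "HOL-Library.Extended_Nonnegative_Real"
begin

definition folner_set :: "('a, 'c) monoid_scheme \<Rightarrow> 'a set \<Rightarrow> nat \<Rightarrow> 'a set \<Rightarrow> bool" where
  (* The comparison takes place in ennreal, where inverse 0 is infinite: every non-empty
     finite subset of G is 0-Folner. *)
  "folner_set G S n F \<longleftrightarrow>
     F \<noteq> {} \<and> finite F \<and> F \<subseteq> carrier G \<and>
     (\<forall>x\<in>S. ennreal (real (card (F - (x <#\<^bsub>G\<^esub> F))) / real (card F)) \<le> inverse (of_nat n))"

definition folner_fun :: "('a, 'c) monoid_scheme \<Rightarrow> 'a set \<Rightarrow> nat \<Rightarrow> enat" where
  (* The infimum in enat is attained unless there is no n-Folner set (G not amenable), in which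
     case the value is infinite. Always at least 1, so a product with an infinite factor
     folner_fun G S n is infinite whatever natural number the_enat (folner_fun G S n) is. *)
  "folner_fun G S n = (INF F \<in> {F. folner_set G S n F}. enat (card F))"

definition word_length :: "('a, 'c) monoid_scheme \<Rightarrow> 'a set \<Rightarrow> 'a \<Rightarrow> nat" where
  (* Meaningful only for g in the subgroup generated by S. *)
  "word_length G S g =
     (LEAST l. \<exists>ws. length ws = l \<and> set ws \<subseteq> S \<union> m_inv G ` S \<and>
        foldr (\<lambda>x y. x \<otimes>\<^bsub>G\<^esub> y) ws \<one>\<^bsub>G\<^esub> = g)"

definition distortion :: "('a, 'c) monoid_scheme \<Rightarrow> 'a set \<Rightarrow> 'a set \<Rightarrow> 'a set \<Rightarrow> nat \<Rightarrow> nat" where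
  (* For finite X generating G the maximum is over a finite set, which contains the identity. *)
  "distortion G X N Y n =
     Max (word_length (G\<lparr>carrier := N\<rparr>) Y ` {w \<in> N. word_length G X w \<le> n})"

text \<open>
  The total recursive functions of arity \<open>k\<close>, as functions on argument lists of length \<open>k\<close>
  (values on lists of other lengths are irrelevant). Minimization is applied only to
  functions that have a zero for all parameters, so all functions in the class are total.
\<close>

inductive recursive_arity :: "nat \<Rightarrow> (nat list \<Rightarrow> nat) \<Rightarrow> bool" where
  zero: "recursive_arity k (\<lambda>_. 0)"
| succ: "recursive_arity 1 (\<lambda>xs. Suc (xs ! 0))"
| proj: "i < k \<Longrightarrow> recursive_arity k (\<lambda>xs. xs ! i)"
| comp: "recursive_arity (length hs) g \<Longrightarrow> (\<forall>h\<in>set hs. recursive_arity k h) \<Longrightarrow>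
     recursive_arity k (\<lambda>xs. g (map (\<lambda>h. h xs) hs))"
| prim_rec: "recursive_arity k g \<Longrightarrow> recursive_arity (Suc (Suc k)) h \<Longrightarrow>
     recursive_arity (Suc k) (\<lambda>xs. rec_nat (g (tl xs)) (\<lambda>m r. h (m # r # tl xs)) (hd xs))"
| minim: "recursive_arity (Suc k) g \<Longrightarrow> (\<forall>xs. length xs = k \<longrightarrow> (\<exists>m. g (m # xs) = 0)) \<Longrightarrow>
     recursive_arity k (\<lambda>xs. LEAST m. g (m # xs) = 0)"

definition recursive_fun :: "(nat \<Rightarrow> nat) \<Rightarrow> bool" where
  "recursive_fun f \<longleftrightarrow> (\<exists>g. recursive_arity 1 g \<and> (\<forall>n. f n = g [n]))"

definition subrecursive :: "(nat \<Rightarrow> enat) \<Rightarrow> bool" where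
  (* In particular a subrecursive function takes only finite values. *)
  "subrecursive F \<longleftrightarrow> (\<exists>f. recursive_fun f \<and> (\<forall>n. F n \<le> enat (f n)))"

end

theory Submission
  imports Defs "HOL-Library.Transitive_Closure_Table"
begin

text \<open>
  Let \<open>A\<close> be a smallest \<open>|X|n\<close>-Folner set of the quotient \<open>K\<close>, with \<open>k\<close> elements, and \<open>E\<close> a smallest
  \<open>m\<close>-Folner set of \<open>N\<close>, where \<open>m = 2nk\<^sup>2\<Delta>(2k + 1)\<close>. If every \<open>g \<in> A\<close> is lifted to some \<open>s(g) \<in> \<Gamma>\<close>, then the
  set of all \<open>s(g)e\<close> with \<open>e \<in> E\<close> has \<open>k|E|\<close> elements. Left translation by \<open>x \<in> X\<close> moves the fibre over \<open>g\<close>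
  to the fibre over \<open>g' = \<rho>(x)g\<close> and, if \<open>g' \<in> A\<close>, displaces it there by the cocycle value
  \<open>s(g')\<^sup>-\<^sup>1xs(g) \<in> N\<close>. So the boundary has two parts: whole fibres over the boundary of \<open>A\<close>, and inside
  the remaining fibres the boundary of \<open>E\<close> under cocycle values. The second part is small if the
  cocycle values are short words in \<open>Y\<close>, since \<open>|E \ cE|\<close> is subadditive in \<open>c\<close>.

  The lifts of points of \<open>A\<close> may have to be long, because \<open>A\<close> need not be connected or near the
  identity. What can be made short is the position relative to a base point \<open>b(g)\<close> of the component of
  \<open>g\<close> in \<open>A\<close>: a path without repetitions inside \<open>A\<close> gives \<open>g = \<rho>(v(g))b(g)\<close> with \<open>|v(g)| \<le> k\<close>
  (lemma \<open>component_lifts\<close>). Therefore \<open>E\<close> is placed in the middle: with any lift \<open>t(g)\<close> of \<open>b(g)\<close>, the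
  Folner set consists of the products \<open>v(g)et(g)\<close>. As \<open>g\<close> and \<open>g'\<close> share the base point, the factor \<open>t\<close>
  cancels, and the cocycle value becomes \<open>v(g')\<^sup>-\<^sup>1xv(g)\<close>, of length at most \<open>2k + 1\<close> in \<open>X\<close> and hence
  at most \<open>\<Delta>(2k + 1)\<close> in \<open>Y\<close> (lemmas \<open>lifted_folner_set\<close> and \<open>folner_fun_extension\<close>).

  Each of the two parts of the boundary must stay below the proportion \<open>1/(2n)\<close>. For the second
  this is the choice of \<open>m\<close>; for the first it follows from \<open>|A \ \<rho>(x)A|/|A| \<le> 1/(|X|n)\<close> if \<open>|X| \<ge> 2\<close> or
  if \<open>A\<close> is invariant. The remaining case is a cyclic \<open>\<Gamma>\<close> with \<open>|A \ \<rho>(x)A| \<ge> 1\<close>; then \<open>k \<ge> n\<close>, and the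
  interval \<open>{1, x, ..., x\<^sup>n\<^sup>-\<^sup>1}\<close> is an \<open>n\<close>-Folner set of \<open>\<Gamma>\<close> with at most \<open>k\<close> elements.

  Subrecursiveness follows because Folner functions and the distortion function are monotone: every
  ingredient of the estimate may be replaced by a recursive upper bound, and recursive functions
  are closed under sums, products and composition.
\<close>

section \<open>Words and word length\<close>

definition word_prod :: "('a, 'c) monoid_scheme \<Rightarrow> 'a list \<Rightarrow> 'a" where
  "word_prod G ws = foldr (\<lambda>x y. x \<otimes>\<^bsub>G\<^esub> y) ws \<one>\<^bsub>G\<^esub>"

abbreviation letters :: "('a, 'c) monoid_scheme \<Rightarrow> 'a set \<Rightarrow> 'a set" where
  "letters G S \<equiv> S \<union> m_inv G ` S"

lemma word_prod_Nil [simp]: "word_prod G [] = \<one>\<^bsub>G\<^esub>"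
  and word_prod_Cons [simp]: "word_prod G (s # ws) = s \<otimes>\<^bsub>G\<^esub> word_prod G ws"
  by (simp_all add: word_prod_def)

lemma word_length_eq:
  "word_length G S g = (LEAST l. \<exists>ws. length ws = l \<and> set ws \<subseteq> letters G S \<and> word_prod G ws = g)"
  by (simp add: word_length_def word_prod_def)

lemma word_length_le:
  "set ws \<subseteq> letters G S \<Longrightarrow> word_length G S (word_prod G ws) \<le> length ws"
  unfolding word_length_eq by (rule Least_le) blast

context group
begin

lemma letters_closed: "S \<subseteq> carrier G \<Longrightarrow> letters G S \<subseteq> carrier G"
  by auto

lemma letters_inv: "S \<subseteq> carrier G \<Longrightarrow> s \<in> letters G S \<Longrightarrow> inv s \<in> letters G S"
  by auto

lemma word_prod_closed: "set ws \<subseteq> carrier G \<Longrightarrow> word_prod G ws \<in> carrier G"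
  by (induction ws) auto

lemma word_prod_append:
  "set us \<subseteq> carrier G \<Longrightarrow> set vs \<subseteq> carrier G \<Longrightarrow>
    word_prod G (us @ vs) = word_prod G us \<otimes> word_prod G vs"
  by (induction us) (auto simp: word_prod_closed m_assoc)

lemma word_prod_inv:
  "set ws \<subseteq> carrier G \<Longrightarrow> word_prod G (rev (map (m_inv G) ws)) = inv (word_prod G ws)"
proof (induction ws)
  case (Cons s ws)
  then have "set (rev (map (m_inv G) ws)) \<subseteq> carrier G" by auto
  then show ?case
    using Cons by (simp add: word_prod_append word_prod_closed inv_mult_group)
qed simp

lemma generate_word:
  assumes "S \<subseteq> carrier G" "g \<in> generate G S"
  shows "\<exists>ws. set ws \<subseteq> letters G S \<and> word_prod G ws = g"
  using assms(2)
proof induction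
  case one
  show ?case by (intro exI[of _ "[]"]) simp
next
  case (incl h)
  then show ?case using assms(1) by (intro exI[of _ "[h]"]) auto
next
  case (inv h)
  then show ?case using assms(1) by (intro exI[of _ "[inv h]"]) auto
next
  case (eng h1 h2)
  then obtain us vs where "set us \<subseteq> letters G S" "word_prod G us = h1"
    "set vs \<subseteq> letters G S" "word_prod G vs = h2" by blast
  moreover have "set us \<subseteq> carrier G" "set vs \<subseteq> carrier G"
    using calculation letters_closed[OF assms(1)] by blast+
  ultimately show ?case
    by (intro exI[of _ "us @ vs"]) (simp add: word_prod_append)
qed

lemma word_length_attained:
  assumes "S \<subseteq> carrier G" "g \<in> generate G S"
  obtains ws where "length ws = word_length G S g" "set ws \<subseteq> letters G S" "word_prod G ws = g"
proof -
  have "\<exists>l ws. length ws = l \<and> set ws \<subseteq> letters G S \<and> word_prod G ws = g"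
    using generate_word[OF assms] by blast
  from LeastI_ex[OF this] show ?thesis
    unfolding word_length_eq[symmetric] using that by blast
qed

lemma finite_word_length_ball:
  assumes "finite S" "S \<subseteq> carrier G" "generate G S = carrier G"
  shows "finite {g \<in> carrier G. word_length G S g \<le> n}"
proof -
  have "{g \<in> carrier G. word_length G S g \<le> n}
      \<subseteq> word_prod G ` {ws. set ws \<subseteq> letters G S \<and> length ws \<le> n}"
  proof
    fix g assume g: "g \<in> {g \<in> carrier G. word_length G S g \<le> n}"
    obtain ws where "length ws = word_length G S g" "set ws \<subseteq> letters G S" "word_prod G ws = g"
      using word_length_attained[of S g] assms(2,3) g by blast
    then show "g \<in> word_prod G ` {ws. set ws \<subseteq> letters G S \<and> length ws \<le> n}"
      using g by (intro image_eqI[of _ _ ws]) auto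
  qed
  moreover have "finite {ws. set ws \<subseteq> letters G S \<and> length ws \<le> n}"
    using assms(1) by (intro finite_lists_length_le) auto
  ultimately show ?thesis by (meson finite_imageI finite_subset)
qed

lemma finite_distortion_set:
  assumes "finite S" "S \<subseteq> carrier G" "generate G S = carrier G" "N \<subseteq> carrier G"
  shows "finite {w \<in> N. word_length G S w \<le> n}"
  by (rule finite_subset[OF _ finite_word_length_ball[OF assms(1-3)]]) (use assms(4) in auto)

lemma word_length_le_distortion:
  assumes "finite S" "S \<subseteq> carrier G" "generate G S = carrier G" "N \<subseteq> carrier G"
    and "w \<in> N" "word_length G S w \<le> n"
  shows "word_length (G\<lparr>carrier := N\<rparr>) Y w \<le> distortion G S N Y n"
  unfolding distortion_def using finite_distortion_set[OF assms(1-4), of n] assms(5,6)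
  by (intro Max_ge) auto

text \<open>
  The trivial element keeps the sets under the maximum non-empty; without it the maximum for the
  smaller radius would be unspecified.
\<close>

lemma distortion_mono:
  assumes "finite S" "S \<subseteq> carrier G" "generate G S = carrier G" "N \<subseteq> carrier G" "\<one> \<in> N"
    and "m \<le> n"
  shows "distortion G S N Y m \<le> distortion G S N Y n"
proof -
  have "word_length G S \<one> \<le> 0"
    using word_length_le[where ws = "[]" and G = G and S = S] by simp
  then have "\<one> \<in> {w \<in> N. word_length G S w \<le> m}"
    using assms(5) by simp
  then show ?thesis
    unfolding distortion_def using finite_distortion_set[OF assms(1-4)] assms(6)
    by (intro Max_mono image_mono finite_imageI) auto
qed

end

section \<open>Folner sets\<close>

lemma l_coset_eq_image: "x <#\<^bsub>G\<^esub> F = (\<lambda>h. x \<otimes>\<^bsub>G\<^esub> h) ` F"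
  by (auto simp: l_coset_def)

text \<open>
  Clearing denominators turns the Folner condition into an inequality of natural numbers, which
  is also the right condition for \<open>n = 0\<close>: it then holds trivially, as does the comparison with the
  infinite value \<open>inverse 0\<close>.
\<close>

lemma folner_set_iff:
  "folner_set G S n F \<longleftrightarrow> F \<noteq> {} \<and> finite F \<and> F \<subseteq> carrier G \<and>
     (\<forall>x\<in>S. n * card (F - (x <#\<^bsub>G\<^esub> F)) \<le> card F)"
proof -
  have "ennreal (real a / real b) \<le> inverse (of_nat n) \<longleftrightarrow> n * a \<le> b" if "b > 0" for a b :: nat
  proof (cases "n = 0")
    case False
    have "inverse (of_nat n :: ennreal) = ennreal (1 / real n)"
      using False by (simp add: ennreal_of_nat_eq_real_of_nat inverse_ennreal inverse_eq_divide)
    then have "ennreal (real a / real b) \<le> inverse (of_nat n) \<longleftrightarrow> real a / real b \<le> 1 / real n"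
      by (simp add: ennreal_le_iff)
    also have "\<dots> \<longleftrightarrow> real (n * a) \<le> real b"
      using False that by (simp add: field_simps)
    finally show ?thesis by (simp only: of_nat_le_iff)
  qed simp
  then show ?thesis
    unfolding folner_set_def using card_gt_0_iff[of F] by auto
qed

lemma folner_fun_le: "folner_set G S n F \<Longrightarrow> folner_fun G S n \<le> enat (card F)"
  unfolding folner_fun_def by (rule INF_lower) simp

lemma folner_fun_ge_1: "1 \<le> folner_fun G S n"
  unfolding folner_fun_def
proof (rule INF_greatest)
  fix F assume "F \<in> {F. folner_set G S n F}"
  then have "card F > 0" by (auto simp: folner_set_iff card_gt_0_iff)
  then show "1 \<le> enat (card F)" by (simp add: one_enat_def)
qed

lemma folner_fun_attained:
  assumes "folner_fun G S n \<noteq> \<infinity>"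
  obtains F where "folner_set G S n F" "folner_fun G S n = enat (card F)"
proof -
  let ?I = "(\<lambda>F. enat (card F)) ` {F. folner_set G S n F}"
  have "?I \<noteq> {}"
  proof
    assume "?I = {}"
    then have "folner_fun G S n = Inf {}" unfolding folner_fun_def by (rule arg_cong)
    then show False using assms by (simp add: top_enat_def)
  qed
  then have "Inf ?I \<in> ?I" by (meson ex_in_conv wellorder_InfI)
  then show ?thesis using that unfolding folner_fun_def by auto
qed

lemma folner_fun_mono:
  assumes "m \<le> n"
  shows "folner_fun G S m \<le> folner_fun G S n"
proof -
  have "folner_set G S m F" if "folner_set G S n F" for F
    using that assms unfolding folner_set_iff by (meson mult_le_mono1 order_trans)
  then show ?thesis unfolding folner_fun_def by (intro INF_superset_mono) auto
qed

context group
begin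

lemma card_l_coset: "x \<in> carrier G \<Longrightarrow> F \<subseteq> carrier G \<Longrightarrow> card (x <# F) = card F"
  unfolding l_coset_eq_image by (intro card_image inj_onI) (auto simp: subset_iff)

text \<open>
  Translating \<open>F \ x\<^sup>-\<^sup>1F\<close> by \<open>x\<close> gives \<open>xF \ F\<close>, which has the size of \<open>F \ xF\<close> because \<open>|xF| = |F|\<close>. So
  the Folner condition for a generating set extends to the inverse generators.
\<close>

lemma card_diff_l_coset_inv:
  assumes "finite F" "F \<subseteq> carrier G" "x \<in> carrier G"
  shows "card (F - (inv x <# F)) = card (F - (x <# F))"
proof -
  have fin: "finite (x <# F)" using assms(1) by (simp add: l_coset_eq_image)
  have "x <# (F - (inv x <# F)) = (x <# F) - F"
  proof -
    have "x \<otimes> f \<in> F \<longleftrightarrow> f \<in> inv x <# F" if "f \<in> F" for f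
    proof
      assume "x \<otimes> f \<in> F"
      then have "inv x \<otimes> (x \<otimes> f) \<in> inv x <# F" by (auto simp: l_coset_eq_image)
      then show "f \<in> inv x <# F"
        using assms that by (simp add: m_assoc[symmetric] subset_iff)
    next
      assume "f \<in> inv x <# F"
      then obtain f' where "f' \<in> F" "f = inv x \<otimes> f'" by (auto simp: l_coset_eq_image)
      then show "x \<otimes> f \<in> F" using assms by (simp add: m_assoc[symmetric] subset_iff)
    qed
    then show ?thesis by (auto simp: l_coset_eq_image[of _ x])
  qed
  then have "card (F - (inv x <# F)) = card ((x <# F) - F)"
    using card_l_coset[OF assms(3), of "F - (inv x <# F)"] assms(2)
    by (metis Diff_subset order_trans)
  also have "\<dots> = card (F - (x <# F))"
    using card_l_coset[OF assms(3,2)] assms(1) fin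
    by (simp add: card_Diff_subset_Int Int_commute)
  finally show ?thesis .
qed

text \<open>Triangle inequality: a point of \<open>F\<close> outside \<open>xyF\<close> is outside \<open>xF\<close> or lies in \<open>x(F \ yF)\<close>.\<close>

lemma card_diff_l_coset_mult:
  assumes "finite F" "F \<subseteq> carrier G" "x \<in> carrier G" "y \<in> carrier G"
  shows "card (F - (x \<otimes> y <# F)) \<le> card (F - (x <# F)) + card (F - (y <# F))"
proof -
  have "F - (x \<otimes> y <# F) \<subseteq> (F - (x <# F)) \<union> (x <# (F - (y <# F)))"
    using assms by (auto simp: l_coset_eq_image m_assoc subset_iff image_iff)
  then have "card (F - (x \<otimes> y <# F)) \<le> card ((F - (x <# F)) \<union> (x <# (F - (y <# F))))"
    using assms(1) by (intro card_mono) (auto simp: l_coset_eq_image)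
  also have "\<dots> \<le> card (F - (x <# F)) + card (x <# (F - (y <# F)))"
    by (rule card_Un_le)
  also have "card (x <# (F - (y <# F))) = card (F - (y <# F))"
    using assms by (intro card_l_coset) auto
  finally show ?thesis .
qed

lemma card_diff_l_coset_word:
  assumes "folner_set G S m F" "S \<subseteq> carrier G" "set ws \<subseteq> letters G S"
  shows "m * card (F - (word_prod G ws <# F)) \<le> length ws * card F"
  using assms(3)
proof (induction ws)
  case Nil
  have "\<one> <# F = F"
    using assms(1) by (simp add: folner_set_iff lcos_mult_one)
  then show ?case by simp
next
  case (Cons s ws)
  note F = assms(1)[unfolded folner_set_iff]
  have s: "s \<in> carrier G" and w: "word_prod G ws \<in> carrier G"
    using Cons.prems letters_closed[OF assms(2)] by (auto intro!: word_prod_closed)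
  have "m * card (F - (s <# F)) \<le> card F"
    using Cons.prems F assms(2) by (auto simp: card_diff_l_coset_inv subset_iff)
  moreover have "m * card (F - (word_prod G ws <# F)) \<le> length ws * card F"
    using Cons by simp
  moreover have "m * card (F - (s \<otimes> word_prod G ws <# F))
      \<le> m * (card (F - (s <# F)) + card (F - (word_prod G ws <# F)))"
    using F s w by (intro mult_le_mono2 card_diff_l_coset_mult) auto
  ultimately show ?case by (simp add: distrib_left)
qed

lemma card_diff_l_coset_word_length:
  assumes "folner_set G S m F" "S \<subseteq> carrier G" "g \<in> generate G S"
  shows "m * card (F - (g <# F)) \<le> word_length G S g * card F"
  using card_diff_l_coset_word[OF assms(1,2)] word_length_attained[OF assms(2,3)] by metis

text \<open>
  The set is \<open>{1, x, ..., x\<^sup>n\<^sup>-\<^sup>1}\<close>, in which only \<open>1\<close> can fail to lie in the translate by \<open>x\<close>. If the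
  powers are distinct, one missing point out of \<open>n\<close> is allowed; if they are not, \<open>x\<close> has an order below
  \<open>n\<close> and \<open>1\<close> is hit as well.
\<close>

lemma cyclic_folner_set:
  assumes x: "x \<in> carrier G" and "n > 0"
  obtains F where "folner_set G {x} n F" "card F \<le> n"
proof
  let ?F = "(\<lambda>i::nat. x [^] i) ` {..<n}"
  show "card ?F \<le> n" using card_image_le[of "{..<n}" "\<lambda>i. x [^] i"] by simp
  have step: "x [^] Suc i \<in> x <# ?F" if "i < n" for i
    unfolding nat_pow_Suc2[OF x] l_coset_eq_image using that by blast
  have sub: "?F - (x <# ?F) \<subseteq> {\<one>}"
  proof
    fix y assume y: "y \<in> ?F - (x <# ?F)"
    then obtain i where i: "i < n" "y = x [^] i" by auto
    show "y \<in> {\<one>}"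
    proof (cases i)
      case (Suc j)
      then show ?thesis using step[of j] i y by auto
    qed (use i in simp)
  qed
  have "n * card (?F - (x <# ?F)) \<le> card ?F"
  proof (cases "inj_on (\<lambda>i::nat. x [^] i) {..<n}")
    case True
    then have "card ?F = n" by (simp add: card_image)
    moreover have "card (?F - (x <# ?F)) \<le> 1" using card_mono[OF _ sub] by simp
    ultimately show ?thesis by simp
  next
    case False
    then obtain i j where ij: "i < j" "j < n" "x [^] i = x [^] j"
      by (auto simp: inj_on_def) (metis linorder_neqE_nat)
    have "x [^] (j - i) = \<one>"
    proof -
      have "x [^] i \<otimes> x [^] (j - i) = x [^] i \<otimes> \<one>"
        using ij x nat_pow_mult[OF x, of i "j - i"] by simp
      then show ?thesis using x by simp
    qed
    moreover have "Suc (j - i - 1) = j - i" "j - i - 1 < n" using ij by auto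
    ultimately have "\<one> \<in> x <# ?F" using step[of "j - i - 1"] by metis
    then have "?F - (x <# ?F) = {}" using subset_singletonD[OF sub] by (metis DiffD2 singletonI)
    then show ?thesis by (metis card.empty mult_0_right zero_le)
  qed
  then show "folner_set G {x} n ?F"
    using assms by (auto simp: folner_set_iff)
qed

end

section \<open>Lifting Folner sets through an extension\<close>

context group_hom
begin

text \<open>
  Reading off the edge labels of a path in the Cayley graph of \<open>H\<close>, restricted to \<open>A\<close>, gives a word
  whose image carries the start of the path to its end.
\<close>

lemma edge_path_word:
  assumes X: "X \<subseteq> carrier G" and A: "A \<subseteq> carrier H"
    and path: "rtrancl_path (\<lambda>u v. u \<in> A \<and> v \<in> A \<and> (\<exists>s\<in>letters G X. v = h s \<otimes>\<^bsub>H\<^esub> u)) b us g"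
    and b: "b \<in> A"
  shows "set us \<subseteq> A \<and> (\<exists>ws. set ws \<subseteq> letters G X \<and> length ws = length us \<and>
           h (word_prod G ws) \<otimes>\<^bsub>H\<^esub> b = g)"
  using path b
proof induction
  case (base x)
  then show ?case using A by (auto intro!: exI[of _ "[]"])
next
  case (step x y ys z)
  then obtain ws s where ws: "set ys \<subseteq> A" "set ws \<subseteq> letters G X" "length ws = length ys"
      "h (word_prod G ws) \<otimes>\<^bsub>H\<^esub> y = z"
    and s: "s \<in> letters G X" "y = h s \<otimes>\<^bsub>H\<^esub> x" and xy: "x \<in> A" "y \<in> A"
    by auto
  have car: "set ws \<subseteq> carrier G" "s \<in> carrier G" "x \<in> carrier H"
    using ws(2) s(1) xy A G.letters_closed[OF X] by blast+
  have "h (word_prod G (ws @ [s])) \<otimes>\<^bsub>H\<^esub> x = z"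
    using car ws(4) s(2)
    by (simp add: G.word_prod_append G.word_prod_closed H.m_assoc)
  then show ?case
    using ws s xy by (intro conjI exI[of _ "ws @ [s]"]) auto
qed

text \<open>
  Here \<open>b\<close> picks a base point in each connected component of \<open>A\<close> and \<open>ws g\<close> reads off a path from it to
  \<open>g\<close>. A path without repeated vertices inside \<open>A\<close> has fewer than \<open>|A|\<close> edges, which bounds the words
  by \<open>|A|\<close>, however far from the identity \<open>A\<close> lies.
\<close>

lemma component_lifts:
  assumes X: "X \<subseteq> carrier G" and A: "finite A" "A \<subseteq> carrier H"
  shows "\<exists>b ws.
    (\<forall>g\<in>A. b g \<in> A \<and> set (ws g) \<subseteq> letters G X \<and> length (ws g) \<le> card A \<and>
       h (word_prod G (ws g)) \<otimes>\<^bsub>H\<^esub> b g = g) \<and>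
    (\<forall>x\<in>X. \<forall>g\<in>A. h x \<otimes>\<^bsub>H\<^esub> g \<in> A \<longrightarrow> b (h x \<otimes>\<^bsub>H\<^esub> g) = b g)"
proof -
  define R where "R = (\<lambda>u v. u \<in> A \<and> v \<in> A \<and> (\<exists>s\<in>letters G X. v = h s \<otimes>\<^bsub>H\<^esub> u))"
  \<comment> \<open>A choice that depends only on the predicate \<open>\<lambda>u. R\<^sup>*\<^sup>* u g\<close>, hence only on the component of \<open>g\<close>.\<close>
  define b where "b g = (SOME u. R\<^sup>*\<^sup>* u g)" for g
  have b: "R\<^sup>*\<^sup>* (b g) g" for g
    unfolding b_def by (rule someI[of _ g]) simp
  have b_in: "b g \<in> A" if "g \<in> A" for g
    using b[of g] by (cases rule: converse_rtranclpE) (use that in \<open>auto simp: R_def\<close>)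
  have "\<exists>ws. set ws \<subseteq> letters G X \<and> length ws \<le> card A \<and> h (word_prod G ws) \<otimes>\<^bsub>H\<^esub> b g = g"
    if "g \<in> A" for g
  proof -
    obtain us where us: "rtrancl_path R (b g) us g" "distinct us"
      using b[of g] unfolding rtranclp_eq_rtrancl_path
      by (metis rtrancl_path_distinct distinct.simps(2))
    from edge_path_word[OF X A(2) us(1)[unfolded R_def] b_in[OF that]] obtain ws where
      "set us \<subseteq> A" "set ws \<subseteq> letters G X" "length ws = length us"
      "h (word_prod G ws) \<otimes>\<^bsub>H\<^esub> b g = g" by blast
    moreover have "length us \<le> card A"
      using us(2) calculation(1) A(1) by (metis card_mono distinct_card)
    ultimately show ?thesis by auto
  qed
  then obtain ws where ws: "\<And>g. g \<in> A \<Longrightarrow> set (ws g) \<subseteq> letters G X \<and> length (ws g) \<le> card A \<and>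
      h (word_prod G (ws g)) \<otimes>\<^bsub>H\<^esub> b g = g" by metis
  have b_edge: "b (h x \<otimes>\<^bsub>H\<^esub> g) = b g" if "x \<in> X" "g \<in> A" "h x \<otimes>\<^bsub>H\<^esub> g \<in> A" for x g
  proof -
    have "g = h (inv x) \<otimes>\<^bsub>H\<^esub> (h x \<otimes>\<^bsub>H\<^esub> g)"
      using that X A(2) by (simp add: H.m_assoc[symmetric] subset_iff)
    then have "R (h x \<otimes>\<^bsub>H\<^esub> g) g" "R g (h x \<otimes>\<^bsub>H\<^esub> g)"
      using that unfolding R_def by blast+
    then have "R\<^sup>*\<^sup>* u (h x \<otimes>\<^bsub>H\<^esub> g) \<longleftrightarrow> R\<^sup>*\<^sup>* u g" for u
      by (meson rtranclp.rtrancl_into_rtrancl)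
    then show ?thesis by (simp add: b_def)
  qed
  show ?thesis using b_in ws b_edge by (intro exI[of _ b] exI[of _ ws]) simp
qed

lemma transition_in_kernel:
  assumes "u \<in> carrier G" "v \<in> carrier G" "x \<in> carrier G" "b \<in> carrier H"
    and "h v \<otimes>\<^bsub>H\<^esub> b = h x \<otimes>\<^bsub>H\<^esub> (h u \<otimes>\<^bsub>H\<^esub> b)"
  shows "inv v \<otimes> x \<otimes> u \<in> kernel G H h"
proof -
  have "h v \<otimes>\<^bsub>H\<^esub> b = (h x \<otimes>\<^bsub>H\<^esub> h u) \<otimes>\<^bsub>H\<^esub> b"
    using assms by (simp add: H.m_assoc)
  then have "h v = h x \<otimes>\<^bsub>H\<^esub> h u"
    using assms by simp
  then have "h (inv v \<otimes> x \<otimes> u) = \<one>\<^bsub>H\<^esub>"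
    using assms by (simp add: H.m_assoc)
  then show ?thesis using assms by (simp add: kernel_def)
qed

text \<open>
  The set \<open>F\<close> consists of the products \<open>v(g)et(b(g))\<close> with \<open>g \<in> A\<close>, \<open>e \<in> E\<close>, where \<open>t\<close> is a section of
  \<open>h\<close>. Such a product lies over \<open>g\<close>, so the parametrisation by \<open>A \<times> E\<close> is injective. If both \<open>g\<close> and
  \<open>k = h(x)g\<close> are in \<open>A\<close>, then \<open>v(k)cv(g)\<^sup>-\<^sup>1 = x\<close> for \<open>c = v(k)\<^sup>-\<^sup>1xv(g)\<close>, and because \<open>b(k) = b(g)\<close> the
  points over \<open>k\<close> missing from \<open>xF\<close> come from \<open>E \ cE\<close>. Half of the allowed boundary is spent on these,
  half on the fibres over \<open>A \ h(x)A\<close>.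
\<close>

lemma lifted_folner_set:
  assumes surj: "h ` carrier G = carrier H" and X: "X \<subseteq> carrier G"
    and A: "finite A" "A \<noteq> {}" "A \<subseteq> carrier H"
    and E: "finite E" "E \<noteq> {}" "E \<subseteq> kernel G H h"
    and v: "\<And>g. g \<in> A \<Longrightarrow> v g \<in> carrier G"
    and b: "\<And>g. g \<in> A \<Longrightarrow> b g \<in> carrier H"
    and vb: "\<And>g. g \<in> A \<Longrightarrow> h (v g) \<otimes>\<^bsub>H\<^esub> b g = g"
    and b_edge: "\<And>x g. x \<in> X \<Longrightarrow> g \<in> A \<Longrightarrow> h x \<otimes>\<^bsub>H\<^esub> g \<in> A \<Longrightarrow> b (h x \<otimes>\<^bsub>H\<^esub> g) = b g"
    and bound_A: "\<And>x. x \<in> X \<Longrightarrow> 2 * n * card (A - (h x <#\<^bsub>H\<^esub> A)) \<le> card A"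
    and bound_E: "\<And>x g. x \<in> X \<Longrightarrow> g \<in> A \<Longrightarrow> h x \<otimes>\<^bsub>H\<^esub> g \<in> A \<Longrightarrow>
      2 * n * card (E - (inv (v (h x \<otimes>\<^bsub>H\<^esub> g)) \<otimes> x \<otimes> v g <# E)) \<le> card E"
  obtains F where "folner_set G X n F" "card F = card A * card E"
proof
  define t where "t = inv_into (carrier G) h"
  have t: "t k \<in> carrier G" "h (t k) = k" if "k \<in> carrier H" for k
    using that surj unfolding t_def by (auto intro: inv_into_into f_inv_into_f)
  define p where "p = (\<lambda>(g, e). v g \<otimes> e \<otimes> t (b g))"
  let ?F = "p ` (A \<times> E)"
  have EG: "e \<in> carrier G" "h e = \<one>\<^bsub>H\<^esub>" if "e \<in> E" for e
    using that E(3) by (auto simp: kernel_def)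
  have hp: "h (p (g, e)) = g" if "g \<in> A" "e \<in> E" for g e
    using that v b vb EG t by (simp add: p_def)
  have inj: "inj_on p (A \<times> E)"
  proof (rule inj_onI, clarify)
    fix g e g' e' assume *: "g \<in> A" "e \<in> E" "g' \<in> A" "e' \<in> E" "p (g, e) = p (g', e')"
    then have "g = g'" using hp by metis
    then show "g = g' \<and> e = e'"
      using * v b EG t by (auto simp: p_def)
  qed
  then show card_F: "card ?F = card A * card E"
    by (simp add: card_image card_cartesian_product)
  have "n * card (?F - (x <# ?F)) \<le> card ?F" if x: "x \<in> X" for x
  proof -
    have xG: "x \<in> carrier G" using x X by blast
    let ?B = "h x <#\<^bsub>H\<^esub> A"
    \<comment> \<open>The displacement of the fibre over \<open>k\<close>, written as a function of the target \<open>k = h(x)g\<close>.\<close>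
    define c where "c k = inv (v k) \<otimes> x \<otimes> v (inv\<^bsub>H\<^esub> h x \<otimes>\<^bsub>H\<^esub> k)" for k
    have c: "c (h x \<otimes>\<^bsub>H\<^esub> g) = inv (v (h x \<otimes>\<^bsub>H\<^esub> g)) \<otimes> x \<otimes> v g" if "g \<in> A" for g
      using that A(3) xG by (simp add: c_def H.m_assoc[symmetric] subset_iff)
    have "p (k, e) \<in> x <# ?F" if k: "k \<in> A" "k \<in> ?B" and e: "e \<in> E" "e \<in> c k <# E" for k e
    proof -
      obtain g where g: "g \<in> A" "k = h x \<otimes>\<^bsub>H\<^esub> g" using k(2) by (auto simp: l_coset_eq_image)
      obtain e' where e': "e' \<in> E" "e = c k \<otimes> e'" using e(2) by (auto simp: l_coset_eq_image)
      have eq: "b k = b g" "e = inv (v k) \<otimes> x \<otimes> v g \<otimes> e'"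
        using b_edge[OF x] g k e' c by auto
      have "p (k, e) = x \<otimes> p (g, e')"
        using eq v[OF k(1)] v[OF g(1)] xG EG(1)[OF e'(1)] t(1)[OF b[OF g(1)]]
        by (simp add: p_def G.m_assoc[symmetric])
      then show ?thesis using g e' by (auto simp: l_coset_eq_image)
    qed
    then have "?F - (x <# ?F)
        \<subseteq> p ` Sigma A (\<lambda>k. if k \<in> ?B then E - (c k <# E) else E)" (is "_ \<subseteq> p ` ?S")
      by (intro subsetI, elim DiffE imageE SigmaE) (auto intro!: imageI)
    then have "card (?F - (x <# ?F)) \<le> card ?S"
      using A(1) E(1) by (intro surj_card_le) auto
    also have "card ?S = (\<Sum>k\<in>A. card (if k \<in> ?B then E - (c k <# E) else E))"
      using A(1) E(1) by (intro card_SigmaI) auto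
    finally have "2 * n * card (?F - (x <# ?F))
        \<le> (\<Sum>k\<in>A. 2 * n * card (if k \<in> ?B then E - (c k <# E) else E))"
      by (simp only: sum_distrib_left[symmetric] mult_le_mono2)
    also have "\<dots> \<le> (\<Sum>k\<in>A. card E + (if k \<in> ?B then 0 else 2 * n * card E))"
    proof (rule sum_mono)
      fix k assume k: "k \<in> A"
      show "2 * n * card (if k \<in> ?B then E - (c k <# E) else E)
          \<le> card E + (if k \<in> ?B then 0 else 2 * n * card E)"
      proof (cases "k \<in> ?B")
        case True
        then obtain g where "g \<in> A" "k = h x \<otimes>\<^bsub>H\<^esub> g" by (auto simp: l_coset_eq_image)
        then show ?thesis using bound_E[OF x, of g] k c True by simp
      qed simp
    qed
    also have "\<dots> = card A * card E + card (A - ?B) * (2 * n * card E)"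
    proof -
      have "(\<Sum>k\<in>A. if k \<in> ?B then 0 else 2 * n * card E) = (\<Sum>k\<in>A - ?B. 2 * n * card E)"
        using A(1) by (intro sum.mono_neutral_cong_right) auto
      then show ?thesis by (simp add: sum.distrib)
    qed
    also have "\<dots> \<le> card A * card E + card A * card E"
      using mult_le_mono1[OF bound_A[OF x], of "card E"] by (simp add: mult_ac)
    finally show ?thesis using card_F by simp
  qed
  moreover have "?F \<subseteq> carrier G"
    using v b EG t by (auto simp: p_def)
  ultimately show "folner_set G X n ?F"
    using A E by (simp add: folner_set_iff)
qed

text \<open>
  The displacements are words of length at most \<open>2k + 1\<close> in \<open>X\<close>, hence products of at most \<open>D\<close> letters
  from \<open>Y\<close>, where \<open>D\<close> is the distortion at \<open>2k + 1\<close>. By subadditivity each of them moves at most the proportion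
  \<open>D/(2nk\<^sup>2D) \<le> 1/(2n)\<close> of a set that is optimal for \<open>N\<close>, as \<open>lifted_folner_set\<close> demands.
\<close>

lemma folner_fun_extension:
  assumes surj: "h ` carrier G = carrier H" and ker: "kernel G H h = N"
    and X: "finite X" "X \<subseteq> carrier G" "generate G X = carrier G"
    and Y: "Y \<subseteq> N" "generate (G\<lparr>carrier := N\<rparr>) Y = N"
    and a: "folner_fun H (h ` X) (card X * n) = enat k"
  shows "folner_fun G X n
    \<le> enat k * folner_fun (G\<lparr>carrier := N\<rparr>) Y (2 * n * k\<^sup>2 * distortion G X N Y (2 * k + 1))"
    (is "_ \<le> _ * folner_fun ?N Y ?m")
proof -
  have subN: "subgroup N G" using subgroup_kernel ker by simp
  then have NG: "N \<subseteq> carrier G" by (rule subgroup.subset)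
  interpret N: group ?N using subN by (rule subgroup.subgroup_is_group) (rule G.group_axioms)
  have YN: "Y \<subseteq> carrier ?N" using Y(1) by simp
  obtain A where folA: "folner_set H (h ` X) (card X * n) A" and k: "k = card A"
    using folner_fun_attained[of H "h ` X" "card X * n"] a by auto
  then have A: "finite A" "A \<noteq> {}" "A \<subseteq> carrier H"
    and bdA: "\<And>x. x \<in> X \<Longrightarrow> card X * n * card (A - (h x <#\<^bsub>H\<^esub> A)) \<le> k"
    by (auto simp: folner_set_iff)
  have kpos: "k > 0" using A k by (simp add: card_gt_0_iff)
  show ?thesis
  proof (cases "folner_fun ?N Y ?m = \<infinity>")
    case True
    then show ?thesis using kpos by (simp add: zero_enat_def)
  next
    case finite_N: False
    show ?thesis
    proof (cases "\<forall>x\<in>X. 2 * n * card (A - (h x <#\<^bsub>H\<^esub> A)) \<le> k")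
      \<comment> \<open>Two generators would already give this bound, so \<open>G\<close> is cyclic here; and \<open>A\<close> is not invariant.\<close>
      case False
      then obtain x where x: "x \<in> X" "\<not> 2 * n * card (A - (h x <#\<^bsub>H\<^esub> A)) \<le> k" by blast
      have "\<not> card X \<ge> 2"
      proof
        assume "card X \<ge> 2"
        then have "2 * (n * card (A - (h x <#\<^bsub>H\<^esub> A))) \<le> card X * (n * card (A - (h x <#\<^bsub>H\<^esub> A)))"
          by (rule mult_le_mono1)
        then show False using x(2) bdA[OF x(1)] unfolding mult.assoc by linarith
      qed
      moreover have "card X > 0" using x X(1) by (auto simp: card_gt_0_iff)
      ultimately have "card X = 1" by linarith
      then have Xx: "X = {x}" using x(1) by (metis card_1_singletonE singletonD)
      have n: "n > 0" and "card (A - (h x <#\<^bsub>H\<^esub> A)) > 0" using x(2) by (auto intro!: gr0I)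
      then have "n * 1 \<le> n * card (A - (h x <#\<^bsub>H\<^esub> A))" by (intro mult_le_mono2) simp
      moreover have "n * card (A - (h x <#\<^bsub>H\<^esub> A)) \<le> k" using bdA[OF x(1)] Xx by simp
      ultimately have nk: "n \<le> k" by linarith
      obtain F where "folner_set G X n F" "card F \<le> n"
        using G.cyclic_folner_set[of x n] x X(2) n Xx by blast
      then have "folner_fun G X n \<le> enat n"
        using folner_fun_le by (metis enat_ord_simps(1) order_trans)
      also have "\<dots> \<le> enat k * 1" using nk by simp
      also have "\<dots> \<le> enat k * folner_fun ?N Y ?m"
        by (intro mult_left_mono folner_fun_ge_1) simp
      finally show ?thesis .
    next
      case True
      obtain E where folE: "folner_set ?N Y ?m E" and E: "folner_fun ?N Y ?m = enat (card E)"
        using folner_fun_attained[OF finite_N] .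
      have E': "finite E" "E \<noteq> {}" "E \<subseteq> N" using folE by (auto simp: folner_set_iff)
      obtain b ws where
        lift: "\<forall>g\<in>A. b g \<in> A \<and> set (ws g) \<subseteq> letters G X \<and> length (ws g) \<le> card A \<and>
          h (word_prod G (ws g)) \<otimes>\<^bsub>H\<^esub> b g = g"
        and edge: "\<forall>x\<in>X. \<forall>g\<in>A. h x \<otimes>\<^bsub>H\<^esub> g \<in> A \<longrightarrow> b (h x \<otimes>\<^bsub>H\<^esub> g) = b g"
        using component_lifts[OF X(2) A(1,3)] by (elim exE conjE)
      have b: "b g \<in> A" if "g \<in> A" for g
        using lift that by blast
      have ws: "set (ws g) \<subseteq> letters G X" "length (ws g) \<le> card A"
        "h (word_prod G (ws g)) \<otimes>\<^bsub>H\<^esub> b g = g" if "g \<in> A" for g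
        using lift that by blast+
      have b_edge: "b (h x \<otimes>\<^bsub>H\<^esub> g) = b g" if "x \<in> X" "g \<in> A" "h x \<otimes>\<^bsub>H\<^esub> g \<in> A" for x g
        using edge that by blast
      define v where "v g = word_prod G (ws g)" for g
      have wsG: "set (ws g) \<subseteq> carrier G" if "g \<in> A" for g
        using ws(1)[OF that] G.letters_closed[OF X(2)] by blast
      have v: "v g \<in> carrier G" if "g \<in> A" for g
        unfolding v_def using wsG[OF that] by (rule G.word_prod_closed)
      have bound_E: "2 * n * card (E - (inv (v (h x \<otimes>\<^bsub>H\<^esub> g)) \<otimes> x \<otimes> v g <# E)) \<le> card E"
        if x: "x \<in> X" and g: "g \<in> A" "h x \<otimes>\<^bsub>H\<^esub> g \<in> A" for x g
      proof -
        let ?g' = "h x \<otimes>\<^bsub>H\<^esub> g" and ?D = "distortion G X N Y (2 * k + 1)"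
        define c where "c = inv (v ?g') \<otimes> x \<otimes> v g"
        have xG: "x \<in> carrier G" using x X(2) by blast
        have "c \<in> N"
          unfolding c_def ker[symmetric]
          by (rule transition_in_kernel[where b = "b g"])
            (use v g xG b A(3) ws(3)[OF g(1)] ws(3)[OF g(2)] b_edge[OF x g] in \<open>auto simp: v_def\<close>)
        then have cY: "c \<in> generate ?N Y" using Y(2) by simp
        let ?us = "rev (map (m_inv G) (ws ?g')) @ x # ws g"
        have "inv s \<in> letters G X" if "s \<in> set (ws ?g')" for s
          using that ws(1)[OF g(2)] G.letters_inv[OF X(2)] by blast
        then have us: "set ?us \<subseteq> letters G X"
          using ws(1)[OF g(1)] x by (simp add: image_subset_iff)
        have "set (rev (map (m_inv G) (ws ?g'))) \<subseteq> carrier G" "set (x # ws g) \<subseteq> carrier G"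
          using wsG[OF g(2)] wsG[OF g(1)] xG by auto
        then have "word_prod G ?us = c"
          using wsG[OF g(2)] v[OF g(1)] v[OF g(2)] xG
          by (simp only: G.word_prod_append G.word_prod_inv) (simp add: c_def v_def G.m_assoc)
        then have "word_length G X c \<le> length ?us" using word_length_le[OF us] by simp
        also have "\<dots> \<le> 2 * k + 1" using ws(2)[OF g(1)] ws(2)[OF g(2)] k by simp
        finally have cD: "word_length ?N Y c \<le> ?D"
          by (rule G.word_length_le_distortion[OF X NG \<open>c \<in> N\<close>])
        have coset: "c <#\<^bsub>?N\<^esub> E = c <# E" by (simp add: l_coset_def)
        have "2 * n * card (E - (c <# E)) \<le> card E"
        proof (cases "?D = 0")
          \<comment> \<open>Then \<open>?m = 0\<close> and \<open>E\<close> satisfies no invariance condition, but \<open>c\<close> is trivial.\<close>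
          case True
          obtain us where us: "length us = word_length ?N Y c" "word_prod ?N us = c"
            using N.word_length_attained[OF YN cY] by blast
          then have "us = []" using cD True by simp
          then have "c = \<one>" using us(2) by simp
          then show ?thesis using G.lcos_mult_one[of E] E'(3) NG by simp
        next
          case False
          have "?D * (2 * n * card (E - (c <# E))) \<le> ?D * (2 * n * k\<^sup>2 * card (E - (c <# E)))"
            using kpos by simp
          also have "\<dots> = ?m * card (E - (c <# E))" by (simp add: mult_ac)
          also have "\<dots> \<le> word_length ?N Y c * card E"
            using N.card_diff_l_coset_word_length[OF folE YN cY] unfolding coset .
          also have "\<dots> \<le> ?D * card E" using cD by (rule mult_le_mono1)
          finally show ?thesis using False by simp
        qed
        then show ?thesis by (simp add: c_def)
      qed
      obtain F where "folner_set G X n F" "card F = card A * card E"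
      proof (rule lifted_folner_set[OF surj X(2) A E'(1,2), where v = v and b = b and n = n])
        show "E \<subseteq> kernel G H h" using E'(3) ker by simp
      qed (use v b A(3) ws(3) b_edge True k bound_E in \<open>auto simp: v_def\<close>)
      then show ?thesis using folner_fun_le[of G X n F] E k by simp
    qed
  qed
qed

end

section \<open>Subrecursive bounds\<close>

text \<open>
  The inductive class speaks about functions on argument lists; the following closure properties
  transfer what is needed to functions on natural numbers, where the two arithmetic operations are
  obtained by primitive recursion on the first summand or factor.
\<close>

lemma recursive_fun_id: "recursive_fun (\<lambda>n. n)"
  unfolding recursive_fun_def
  by (rule exI[of _ "\<lambda>xs. xs ! 0"]) (simp add: recursive_arity.proj)

lemma recursive_fun_binary:
  assumes "recursive_arity 2 p" "recursive_fun f" "recursive_fun g"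
  shows "recursive_fun (\<lambda>n. p [f n, g n])"
proof -
  from assms(2,3) obtain f' g' where "recursive_arity 1 f'" "recursive_arity 1 g'"
    and eq: "\<And>n. f n = f' [n]" "\<And>n. g n = g' [n]"
    unfolding recursive_fun_def by blast
  then have "recursive_arity 1 (\<lambda>xs. p (map (\<lambda>h. h xs) [f', g']))" (is "recursive_arity 1 ?r")
    using assms(1) by (intro recursive_arity.comp) (auto simp: numeral_2_eq_2)
  moreover have "\<forall>n. p [f n, g n] = ?r [n]" by (simp add: eq)
  ultimately show ?thesis unfolding recursive_fun_def by blast
qed

lemma recursive_fun_comp:
  assumes "recursive_fun f" "recursive_fun g"
  shows "recursive_fun (\<lambda>n. f (g n))"
proof -
  from assms obtain f' g' where "recursive_arity 1 f'" "recursive_arity 1 g'"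
    and eq: "\<And>n. f n = f' [n]" "\<And>n. g n = g' [n]"
    unfolding recursive_fun_def by blast
  then have "recursive_arity 1 (\<lambda>xs. f' (map (\<lambda>h. h xs) [g']))" (is "recursive_arity 1 ?r")
    by (intro recursive_arity.comp) auto
  moreover have "\<forall>n. f (g n) = ?r [n]" by (simp add: eq)
  ultimately show ?thesis unfolding recursive_fun_def by blast
qed

lemma recursive_fun_const: "recursive_fun (\<lambda>_. c)"
proof (induction c)
  case 0
  show ?case unfolding recursive_fun_def
    by (rule exI[of _ "\<lambda>_. 0"]) (simp add: recursive_arity.zero)
next
  case (Suc c)
  have "recursive_fun Suc" unfolding recursive_fun_def
    by (rule exI[of _ "\<lambda>xs. Suc (xs ! 0)"]) (simp add: recursive_arity.succ[simplified])
  from recursive_fun_comp[OF this Suc] show ?case .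
qed

lemma recursive_add: "\<exists>p. recursive_arity 2 p \<and> (\<forall>a b. p [a, b] = a + b)"
proof (intro exI conjI allI)
  have "recursive_arity (Suc (Suc 1)) (\<lambda>xs. (\<lambda>ys. Suc (ys ! 0)) (map (\<lambda>h. h xs) [\<lambda>xs. xs ! 1]))"
    by (rule recursive_arity.comp)
      (auto simp: recursive_arity.succ[simplified] intro!: recursive_arity.proj)
  from recursive_arity.prim_rec[OF recursive_arity.proj[of 0 1] this]
  show "recursive_arity 2 (\<lambda>xs. rec_nat (tl xs ! 0) (\<lambda>m r. Suc r) (hd xs))"
    by (simp add: numeral_2_eq_2)
  show "rec_nat (tl [a, b] ! 0) (\<lambda>m r. Suc r) (hd [a, b]) = a + b" for a b :: nat
    by (induction a) auto
qed

lemma recursive_mult: "\<exists>p. recursive_arity 2 p \<and> (\<forall>a b. p [a, b] = a * b)"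
proof -
  obtain q where q: "recursive_arity 2 q" "\<And>a b. q [a, b] = a + b"
    using recursive_add by blast
  show ?thesis
  proof (intro exI conjI allI)
    have "recursive_arity (Suc (Suc 1)) (\<lambda>xs. q (map (\<lambda>h. h xs) [\<lambda>xs. xs ! 1, \<lambda>xs. xs ! 2]))"
      using q(1) by (intro recursive_arity.comp) (auto simp: numeral_2_eq_2 intro!: recursive_arity.proj)
    from recursive_arity.prim_rec[OF recursive_arity.zero this]
    show "recursive_arity 2 (\<lambda>xs. rec_nat 0 (\<lambda>m r. r + tl xs ! 0) (hd xs))"
      by (simp add: numeral_2_eq_2 q(2))
    show "rec_nat 0 (\<lambda>m r. r + tl [a, b] ! 0) (hd [a, b]) = a * b" for a b :: nat
      by (induction a) auto
  qed
qed

lemma recursive_fun_add: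
  assumes "recursive_fun f" "recursive_fun g"
  shows "recursive_fun (\<lambda>n. f n + g n)"
proof -
  obtain p where "recursive_arity 2 p" "\<And>a b. p [a, b] = a + b"
    using recursive_add by blast
  then show ?thesis using recursive_fun_binary[of p f g] assms by simp
qed

lemma recursive_fun_mult:
  assumes "recursive_fun f" "recursive_fun g"
  shows "recursive_fun (\<lambda>n. f n * g n)"
proof -
  obtain p where "recursive_arity 2 p" "\<And>a b. p [a, b] = a * b"
    using recursive_mult by blast
  then show ?thesis using recursive_fun_binary[of p f g] assms by simp
qed

section \<open>Folner functions of extensions\<close>

theorem corollary4p3:
  fixes \<Gamma> :: "('a, 'c) monoid_scheme"
    and K :: "('b, 'd) monoid_scheme"
    and \<rho> :: "'a \<Rightarrow> 'b"
    and N X Y :: "'a set"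
  assumes "group_hom \<Gamma> K \<rho>"
    and "\<rho> ` carrier \<Gamma> = carrier K"
    and "N \<lhd> \<Gamma>"
    and "kernel \<Gamma> K \<rho> = N"
    and "finite X" and "X \<subseteq> carrier \<Gamma>" and "generate \<Gamma> X = carrier \<Gamma>"
    and "finite Y" and "Y \<subseteq> N" and "generate (\<Gamma>\<lparr>carrier := N\<rparr>) Y = N"
  shows "(\<forall>n::nat.
            let a = folner_fun K (\<rho> ` X) (card X * n); k = the_enat a in
            folner_fun \<Gamma> X n
              \<le> a * folner_fun (\<Gamma>\<lparr>carrier := N\<rparr>) Y
                      (2 * n * k\<^sup>2 * distortion \<Gamma> X N Y (2 * k + 1))) \<and>
         (subrecursive (folner_fun (\<Gamma>\<lparr>carrier := N\<rparr>) Y) \<and>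
          subrecursive (folner_fun K (\<rho> ` X)) \<and>
          subrecursive (\<lambda>n. enat (distortion \<Gamma> X N Y n)) \<longrightarrow>
          subrecursive (folner_fun \<Gamma> X))"
proof (intro conjI allI impI)
  interpret group_hom \<Gamma> K \<rho> by fact
  let ?N = "\<Gamma>\<lparr>carrier := N\<rparr>" and ?D = "distortion \<Gamma> X N Y"
  note extension = folner_fun_extension[OF assms(2,4,5,6,7,9,10)]
  show "let a = folner_fun K (\<rho> ` X) (card X * n); k = the_enat a in
      folner_fun \<Gamma> X n \<le> a * folner_fun ?N Y (2 * n * k\<^sup>2 * ?D (2 * k + 1))" for n
  proof (cases "folner_fun K (\<rho> ` X) (card X * n)")
    case (enat k)
    then show ?thesis using extension[of n k] by (simp add: Let_def)
  next
    case infinity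
    have "\<infinity> * folner_fun ?N Y m = \<infinity>" for m
      using folner_fun_ge_1[of ?N Y m] by (intro imult_infinity) (auto simp: zero_less_iff_neq_zero)
    then show ?thesis unfolding infinity Let_def by simp
  qed
  assume "subrecursive (folner_fun ?N Y) \<and> subrecursive (folner_fun K (\<rho> ` X)) \<and>
    subrecursive (\<lambda>n. enat (?D n))"
  then obtain f q d where rec: "recursive_fun f" "recursive_fun q" "recursive_fun d"
    and f: "\<And>n. folner_fun ?N Y n \<le> enat (f n)"
    and q: "\<And>n. folner_fun K (\<rho> ` X) n \<le> enat (q n)"
    and d: "\<And>n. ?D n \<le> d n"
    unfolding subrecursive_def by auto
  define q' where "q' n = q (card X * n)" for n
  define r where "r n = q' n * f (2 * n * (q' n * q' n) * d (2 * q' n + 1))" for n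
  have "recursive_fun q'" unfolding q'_def
    by (intro recursive_fun_comp[OF rec(2)] recursive_fun_mult recursive_fun_const recursive_fun_id)
  then have "recursive_fun r" unfolding r_def
    by (intro recursive_fun_mult recursive_fun_comp[OF rec(1)] recursive_fun_comp[OF rec(3)]
        recursive_fun_add recursive_fun_const recursive_fun_id)
  moreover have "folner_fun \<Gamma> X n \<le> enat (r n)" for n
  proof -
    obtain k where k: "folner_fun K (\<rho> ` X) (card X * n) = enat k" "k \<le> q' n"
      using q[of "card X * n"] unfolding q'_def
      by (cases "folner_fun K (\<rho> ` X) (card X * n)") auto
    have one: "\<one>\<^bsub>\<Gamma>\<^esub> \<in> N" and sub: "N \<subseteq> carrier \<Gamma>"
      using assms(4) by (auto simp: kernel_def)
    have "?D (2 * k + 1) \<le> d (2 * q' n + 1)"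
      using G.distortion_mono[OF assms(5,6,7) sub one, of "2 * k + 1" "2 * q' n + 1" Y] k(2)
        d[of "2 * q' n + 1"] by linarith
    moreover have "k\<^sup>2 \<le> q' n * q' n"
      using k(2) by (simp add: power2_eq_square mult_le_mono)
    ultimately have "2 * n * k\<^sup>2 * ?D (2 * k + 1) \<le> 2 * n * (q' n * q' n) * d (2 * q' n + 1)"
      by (intro mult_le_mono) auto
    then have "folner_fun ?N Y (2 * n * k\<^sup>2 * ?D (2 * k + 1))
        \<le> enat (f (2 * n * (q' n * q' n) * d (2 * q' n + 1)))"
      using folner_fun_mono f order_trans by blast
    then have "enat k * folner_fun ?N Y (2 * n * k\<^sup>2 * ?D (2 * k + 1)) \<le> enat (r n)"
      unfolding r_def times_enat_simps(1)[symmetric] using k(2) by (intro mult_mono) auto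
    then show ?thesis using extension[OF k(1)] by (rule order_trans[rotated])
  qed
  ultimately show "subrecursive (folner_fun \<Gamma> X)"
    unfolding subrecursive_def by blast
qed

end
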